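(* For each odd prime $p$ and each non-negative integer $k$ there exists a quaternary orthogonal design $\mathrm{COD}\big((1+p^2)p^{2k};\,p^{2k},\,p^{2k+2}\big)$.
   Context: Let $x_1,\dots,x_m$ be commuting real indeterminates. A quaternary orthogonal design $\mathrm{COD}(n;s_1,\dots,s_m)$ of order $n$ and type $(s_1,\dots,s_m)$ is an $n\times n$ matrix $D$ with entries from $\{0\}\cup\{\pm x_\ell,\pm i x_\ell : 1\le \ell\le m\}$ such that $DD^*=\big(\sum_{\ell=1}^m s_\ell x_\ell^2\big) I_n$, where $D^*$ denotes the conjugate transpose. *)

theory Defs
  imports
    "HOL-Library.Poly_Mapping"
    "HOL-Computational_Algebra.Primes"
    "Jordan_Normal_Form.Matrix"
begin

text \<open>
  Polynomials over the complex numbers in commuting indeterminates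
  \<open>x\<^sub>0, x\<^sub>1, \<dots>\<close>, as finitely supported functions from monomials to coefficients;
  a monomial is a finitely supported exponent function.
\<close>

type_synonym cpoly = "(nat \<Rightarrow>\<^sub>0 nat) \<Rightarrow>\<^sub>0 complex"

definition cpoly_const :: "complex \<Rightarrow> cpoly" where
  "cpoly_const c = Poly_Mapping.single 0 c"

definition indet :: "nat \<Rightarrow> cpoly" where
  "indet l = Poly_Mapping.single (Poly_Mapping.single l 1) 1"

text \<open>The indeterminates are real, so conjugation acts on the coefficients only.\<close>

definition cpoly_cnj :: "cpoly \<Rightarrow> cpoly" where
  "cpoly_cnj f = Poly_Mapping.map cnj f"

definition conj_transpose :: "cpoly mat \<Rightarrow> cpoly mat" where
  "conj_transpose D = transpose_mat (map_mat cpoly_cnj D)"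

text \<open>
  The type \<open>(s\<^sub>1, \<dots>, s\<^sub>m)\<close> of a design is the list \<open>s\<close>, so \<open>m = length s\<close>;
  the indeterminates are numbered from \<open>0\<close>, and \<open>s ! l\<close> belongs to \<open>indet l\<close>.
\<close>

definition is_COD :: "nat \<Rightarrow> nat list \<Rightarrow> cpoly mat \<Rightarrow> bool" where
  "is_COD n s D \<longleftrightarrow>
     D \<in> carrier_mat n n \<and>
     elements_mat D \<subseteq>
       {0} \<union> {cpoly_const u * indet l | u l. u \<in> {1, - 1, \<i>, - \<i>} \<and> l < length s} \<and>
     D * conj_transpose D = (\<Sum>l<length s. of_nat (s ! l) * indet l ^ 2) \<cdot>\<^sub>m 1\<^sub>m n"

end

(*
  Let q = p^2. A core is a symmetric q x q matrix Q with zero diagonal, entries +-1 off the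
  diagonal, Q J = 0 and Q Q^T = q I - J. Bordering Q by ones gives a symmetric conference matrix C,
  so i x_0 I + x_1 C is a design of type (1, q). If x_0 P + x_1 S is a design of type (a, q a), then
  replacing x_0 by i x_1 J and x_1 by i x_0 I + x_1 Q (as Kronecker factors) gives one of
  type (q a, q^2 a): the cross terms cancel because P S* + S P* = 0.

  Instead of the quadratic character of GF(p^2), the core comes from the affine plane over Z_p:
  it is the signed sum, over the p + 1 (an even number of) parallel classes with alternating signs,
  of the matrices A_c of the relation "on a common line of class c". Indeed A_c^2 = p A_c,
  A_c A_d = J for c \<noteq> d, and the A_c sum to J + p I.
*)

theory Submission
  imports Defs "HOL-Number_Theory.Cong"
begin

section \<open>Matrices as functions on arbitrary index sets, cores and designs\<close>

definition gram :: "'a set \<Rightarrow> ('a \<Rightarrow> 'a \<Rightarrow> complex) \<Rightarrow> ('a \<Rightarrow> 'a \<Rightarrow> complex) \<Rightarrow> 'a \<Rightarrow> 'a \<Rightarrow> complex"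
  where "gram I A B i j = (\<Sum>k\<in>I. A i k * cnj (B j k))"

definition kron :: "('a \<Rightarrow> 'a \<Rightarrow> complex) \<Rightarrow> ('b \<Rightarrow> 'b \<Rightarrow> complex) \<Rightarrow> 'a \<times> 'b \<Rightarrow> 'a \<times> 'b \<Rightarrow> complex"
  where "kron A B x y = A (fst x) (fst y) * B (snd x) (snd y)"

definition delta :: "'a \<Rightarrow> 'a \<Rightarrow> complex"
  where "delta i j = of_bool (i = j)"

definition all_ones :: "'a \<Rightarrow> 'a \<Rightarrow> complex"
  where "all_ones i j = 1"

definition quaternary_units :: "complex set"
  where "quaternary_units = {1, - 1, \<i>, - \<i>}"

definition core_matrix :: "'a set \<Rightarrow> ('a \<Rightarrow> 'a \<Rightarrow> complex) \<Rightarrow> bool" where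
  "core_matrix F Q \<longleftrightarrow> finite F \<and>
     (\<forall>u\<in>F. Q u u = 0) \<and>
     (\<forall>u\<in>F. \<forall>v\<in>F. u \<noteq> v \<longrightarrow> Q u v \<in> {1, - 1}) \<and>
     (\<forall>u\<in>F. \<forall>v\<in>F. Q u v = Q v u) \<and>
     (\<forall>u\<in>F. (\<Sum>w\<in>F. Q u w) = 0) \<and>
     (\<forall>u\<in>F. \<forall>v\<in>F. gram F Q Q u v = of_nat (card F) * delta u v - 1)"

text \<open>The design \<open>x\<^sub>0 P + x\<^sub>1 S\<close>, with rows and columns indexed by \<open>I\<close>.\<close>

definition design_pair ::
  "'a set \<Rightarrow> nat \<Rightarrow> nat \<Rightarrow> ('a \<Rightarrow> 'a \<Rightarrow> complex) \<Rightarrow> ('a \<Rightarrow> 'a \<Rightarrow> complex) \<Rightarrow> bool" where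
  "design_pair I a b P S \<longleftrightarrow>
     (\<forall>i\<in>I. \<forall>j\<in>I. P i j = 0 \<and> S i j \<in> insert 0 quaternary_units \<or>
                   S i j = 0 \<and> P i j \<in> insert 0 quaternary_units) \<and>
     (\<forall>i\<in>I. \<forall>j\<in>I. gram I P P i j = of_nat a * delta i j) \<and>
     (\<forall>i\<in>I. \<forall>j\<in>I. gram I S S i j = of_nat b * delta i j) \<and>
     (\<forall>i\<in>I. \<forall>j\<in>I. gram I P S i j + gram I S P i j = 0)"

section \<open>Calculus of \<open>gram\<close>, the entries of A B* for matrices indexed by
  \<open>I\<close>\<close>

lemma gram_add_left: "gram I (\<lambda>i j. A i j + B i j) C i j = gram I A C i j + gram I B C i j"
  by (simp add: gram_def algebra_simps sum.distrib)

lemma gram_add_right: "gram I C (\<lambda>i j. A i j + B i j) i j = gram I C A i j + gram I C B i j"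
  by (simp add: gram_def algebra_simps sum.distrib)

lemma gram_scale_left: "gram I (\<lambda>i j. c * A i j) B i j = c * gram I A B i j"
  by (simp add: gram_def sum_distrib_left mult_ac)

lemma gram_scale_right: "gram I A (\<lambda>i j. c * B i j) i j = cnj c * gram I A B i j"
  by (simp add: gram_def sum_distrib_left mult_ac)

lemma gram_kron:
  "gram (F \<times> I) (kron A B) (kron C D) x y = gram F A C (fst x) (fst y) * gram I B D (snd x) (snd y)"
  unfolding gram_def kron_def sum_product
  by (simp add: sum.cartesian_product case_prod_unfold mult_ac)

lemma gram_reindex:
  assumes "bij_betw h J I"
  shows "gram J (\<lambda>i j. A (h i) (h j)) (\<lambda>i j. B (h i) (h j)) i j = gram I A B (h i) (h j)"
  unfolding gram_def using assms by (rule sum.reindex_bij_betw)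

lemma gram_delta_right:
  assumes "finite I" "j \<in> I"
  shows "gram I A delta i j = A i j"
proof -
  have "gram I A delta i j = (\<Sum>k\<in>I. if k = j then A i k else 0)"
    unfolding gram_def delta_def by (intro sum.cong) auto
  then show ?thesis using assms by simp
qed

lemma gram_delta_left:
  assumes "finite I" "i \<in> I"
  shows "gram I delta A i j = cnj (A j i)"
proof -
  have "gram I delta A i j = (\<Sum>k\<in>I. if k = i then cnj (A j k) else 0)"
    unfolding gram_def delta_def by (intro sum.cong) auto
  then show ?thesis using assms by simp
qed

lemma delta_prod: "delta x y = delta (fst x) (fst y) * delta (snd x) (snd y)"
  by (simp add: delta_def prod_eq_iff of_bool_conj)

lemma core_matrix_cnj:
  assumes "core_matrix F Q" "u \<in> F" "v \<in> F"
  shows "cnj (Q u v) = Q u v"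
proof -
  have "Q u v \<in> {0, 1, - 1}"
    using assms unfolding core_matrix_def by (cases "u = v") blast+
  then show ?thesis by auto
qed

text \<open>Rows and columns are relabelled simultaneously. This frees the construction to use
  products and option types as index sets and to return to \<open>{..<n}\<close> afterwards.\<close>

lemma design_pair_reindex:
  assumes h: "bij_betw h J I" and d: "design_pair I a b P S"
  shows "design_pair J a b (\<lambda>i j. P (h i) (h j)) (\<lambda>i j. S (h i) (h j))"
proof -
  have hI: "h i \<in> I" if "i \<in> J" for i using h that by (auto simp: bij_betw_def)
  have "delta (h i) (h j) = delta i j" if "i \<in> J" "j \<in> J" for i j
    using h that by (auto simp: delta_def bij_betw_def inj_on_def)
  then show ?thesis
    using d hI unfolding design_pair_def by (simp add: gram_reindex[OF h])
qed

section \<open>The Kronecker step and the bordered starting design\<close>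

lemma design_pair_kron:
  assumes Q: "core_matrix F Q" and d: "design_pair I a b P S" and b: "b = card F * a"
  shows "design_pair (F \<times> I) b (card F * b)
           (\<lambda>x y. \<i> * kron delta S x y)
           (\<lambda>x y. \<i> * kron all_ones P x y + kron Q S x y)"
proof -
  have fin: "finite F" using Q by (simp add: core_matrix_def)
  have dd: "gram F delta delta u v = delta u v" if "u \<in> F" "v \<in> F" for u v
    using gram_delta_right[OF fin] that by simp
  have dJ: "gram F delta all_ones u v = 1" "gram F all_ones delta u v = 1" if "u \<in> F" "v \<in> F" for u v
    using gram_delta_right[OF fin] gram_delta_left[OF fin] that by (simp_all add: all_ones_def)
  have dQ: "gram F delta Q u v = Q u v" "gram F Q delta u v = Q u v" if "u \<in> F" "v \<in> F" for u v
    using gram_delta_right[OF fin] gram_delta_left[OF fin] that core_matrix_cnj[OF Q] Q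
    by (simp_all add: core_matrix_def)
  have JJ: "gram F all_ones all_ones u v = of_nat (card F)" for u v
    by (simp add: gram_def all_ones_def)
  have Qsum: "(\<Sum>w\<in>F. Q u w) = 0" if "u \<in> F" for u
    using Q that unfolding core_matrix_def by blast
  have QJ: "gram F Q all_ones u v = 0" if "u \<in> F" for u v
    using Qsum[OF that] by (simp add: gram_def all_ones_def)
  have JQ: "gram F all_ones Q u v = 0" if "v \<in> F" for u v
  proof -
    have "gram F all_ones Q u v = (\<Sum>w\<in>F. Q v w)"
      unfolding gram_def all_ones_def using core_matrix_cnj[OF Q that] by simp
    then show ?thesis using Qsum[OF that] by simp
  qed
  have QQ: "gram F Q Q u v = of_nat (card F) * delta u v - 1" if "u \<in> F" "v \<in> F" for u v
    using Q that by (simp add: core_matrix_def)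
  have PP: "gram I P P i j = of_nat a * delta i j"
    and SS: "gram I S S i j = of_nat b * delta i j"
    and PS: "gram I P S i j = - gram I S P i j" if "i \<in> I" "j \<in> I" for i j
    using d that by (simp_all add: design_pair_def eq_neg_iff_add_eq_0)
  have ent: "P i j = 0 \<and> S i j \<in> insert 0 quaternary_units \<or>
             S i j = 0 \<and> P i j \<in> insert 0 quaternary_units" if "i \<in> I" "j \<in> I" for i j
    using d that by (simp add: design_pair_def)
  note gs = gram_add_left gram_add_right gram_scale_left gram_scale_right gram_kron
  show ?thesis
    unfolding design_pair_def
  proof (intro conjI ballI)
    fix x y assume xy: "x \<in> F \<times> I" "y \<in> F \<times> I"
    then have m: "fst x \<in> F" "fst y \<in> F" "snd x \<in> I" "snd y \<in> I" by auto
    have i_unit: "\<i> * c \<in> insert 0 quaternary_units" "- c \<in> insert 0 quaternary_units"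
      if "c \<in> insert 0 quaternary_units" for c
      using that by (auto simp: quaternary_units_def)
    have Qc: "Q (fst x) (fst y) = 0 \<and> fst x = fst y \<or>
              (Q (fst x) (fst y) = 1 \<or> Q (fst x) (fst y) = - 1) \<and> fst x \<noteq> fst y"
      using Q m unfolding core_matrix_def by (cases "fst x = fst y") auto
    \<comment> \<open>\<open>P\<close> and \<open>S\<close> have disjoint supports, and so do
      \<open>delta\<close> and \<open>Q\<close>. Hence at most one of the three Kronecker terms is
      nonzero at any position.\<close>
    show "\<i> * kron delta S x y = 0 \<and>
          \<i> * kron all_ones P x y + kron Q S x y \<in> insert 0 quaternary_units \<or>
          \<i> * kron all_ones P x y + kron Q S x y = 0 \<and>
          \<i> * kron delta S x y \<in> insert 0 quaternary_units"
      using ent[OF m(3,4)] Qc i_unit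
      unfolding kron_def delta_def all_ones_def by fastforce
    show "gram (F \<times> I) (\<lambda>x y. \<i> * kron delta S x y) (\<lambda>x y. \<i> * kron delta S x y) x y
          = of_nat b * delta x y"
      using m by (simp add: gs dd SS delta_prod[of x y] flip: mult.assoc)
    \<comment> \<open>The mixed terms contain J Q or Q J and vanish. With q = \<open>card F\<close>,
      what remains is q J (x) a I + (q I - J) (x) b I, and \<open>b = q * a\<close> cancels the J
      parts.\<close>
    show "gram (F \<times> I) (\<lambda>x y. \<i> * kron all_ones P x y + kron Q S x y)
            (\<lambda>x y. \<i> * kron all_ones P x y + kron Q S x y) x y = of_nat (card F * b) * delta x y"
      using m by (simp add: gs JJ JQ QJ QQ PP SS delta_prod[of x y] b algebra_simps)
    \<comment> \<open>The terms Q (x) S S* carry the factors i and -i and cancel. Since i times its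
      conjugate is 1, the rest is J (x) the sum of S P* and P S*, which is zero.\<close>
    show "gram (F \<times> I) (\<lambda>x y. \<i> * kron delta S x y)
            (\<lambda>x y. \<i> * kron all_ones P x y + kron Q S x y) x y
        + gram (F \<times> I) (\<lambda>x y. \<i> * kron all_ones P x y + kron Q S x y)
            (\<lambda>x y. \<i> * kron delta S x y) x y = 0"
      using m by (simp add: gs dJ dQ PS SS algebra_simps)
  qed
qed

text \<open>The border index is \<open>None\<close>. For a core \<open>Q\<close> this is a symmetric
  conference matrix of order \<open>card F + 1\<close>.\<close>

definition bordered :: "('a \<Rightarrow> 'a \<Rightarrow> complex) \<Rightarrow> 'a option \<Rightarrow> 'a option \<Rightarrow> complex" where
  "bordered Q x y = (case (x, y) of
     (None, None) \<Rightarrow> 0 | (Some u, Some v) \<Rightarrow> Q u v | _ \<Rightarrow> 1)"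

lemma design_pair_bordered:
  assumes Q: "core_matrix F Q"
  shows "design_pair (insert None (Some ` F)) 1 (card F) (\<lambda>x y. \<i> * delta x y) (bordered Q)"
proof -
  let ?I = "insert None (Some ` F)"
  have fin: "finite F" and finI: "finite ?I" using Q by (simp_all add: core_matrix_def)
  have real: "cnj (bordered Q x y) = bordered Q x y" if "x \<in> ?I" "y \<in> ?I" for x y
    using that core_matrix_cnj[OF Q] by (auto simp: bordered_def)
  have sym: "bordered Q x y = bordered Q y x" if "x \<in> ?I" "y \<in> ?I" for x y
    using that Q by (auto simp: bordered_def core_matrix_def)
  have sumI: "(\<Sum>x\<in>?I. g x) = g None + (\<Sum>u\<in>F. g (Some u))" for g :: "'a option \<Rightarrow> complex"
    using fin by (simp add: sum.reindex)
  have Qsum: "(\<Sum>w\<in>F. Q u w) = 0" if "u \<in> F" for u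
    using Q that unfolding core_matrix_def by blast
  have Qsum': "(\<Sum>w\<in>F. cnj (Q u w)) = 0" if "u \<in> F" for u
    using Qsum[OF that] core_matrix_cnj[OF Q that] by simp
  have QQ: "(\<Sum>w\<in>F. Q u w * cnj (Q v w)) = of_nat (card F) * delta u v - 1" if "u \<in> F" "v \<in> F" for u v
    using Q that unfolding core_matrix_def gram_def by blast
  show ?thesis
    unfolding design_pair_def
  proof (intro conjI ballI)
    fix x y assume xy: "x \<in> ?I" "y \<in> ?I"
    show "\<i> * delta x y = 0 \<and> bordered Q x y \<in> insert 0 quaternary_units \<or>
          bordered Q x y = 0 \<and> \<i> * delta x y \<in> insert 0 quaternary_units"
    proof (cases "x = y")
      case True
      then have "bordered Q x y = 0"
        using xy Q by (auto simp: bordered_def core_matrix_def)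
      then show ?thesis by (simp add: delta_def True quaternary_units_def)
    next
      case False
      have unit: "Q u v = 1 \<or> Q u v = - 1" if "u \<in> F" "v \<in> F" "u \<noteq> v" for u v
        using Q that unfolding core_matrix_def by blast
      have "bordered Q x y \<in> {1, - 1}"
        using xy False by (auto simp: bordered_def dest: unit)
      then show ?thesis by (auto simp: delta_def False quaternary_units_def)
    qed
    show "gram ?I (\<lambda>x y. \<i> * delta x y) (\<lambda>x y. \<i> * delta x y) x y = of_nat 1 * delta x y"
      unfolding gram_scale_left gram_scale_right gram_delta_right[OF finI xy(2)] by simp
    \<comment> \<open>For two inner rows the border column adds 1, cancelling the -1 in the Gram sum
      of the core. The border row is orthogonal to the inner rows because the rows of
      \<open>Q\<close> sum to zero.\<close>
    show "gram ?I (bordered Q) (bordered Q) x y = of_nat (card F) * delta x y"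
      unfolding gram_def sumI using xy Qsum Qsum' QQ
      by (auto simp: bordered_def delta_def)
    \<comment> \<open>The two summands are i C* and -i C for the bordered matrix C, which is real
      and symmetric.\<close>
    show "gram ?I (\<lambda>x y. \<i> * delta x y) (bordered Q) x y
        + gram ?I (bordered Q) (\<lambda>x y. \<i> * delta x y) x y = 0"
      unfolding gram_scale_left gram_scale_right gram_delta_right[OF finI xy(2)]
        gram_delta_left[OF finI xy(1)]
      using real[OF xy(2,1)] sym[OF xy] by simp
  qed
qed

text \<open>The bordered core starts the induction. Each Kronecker step multiplies the order and
  both weights by \<open>card F\<close>, so the ratio of the weights stays \<open>card F\<close>, as
  the next step requires.\<close>

lemma design_pair_exists:
  assumes Q: "core_matrix F Q"
  shows "\<exists>P S. design_pair {..<(1 + card F) * card F ^ k} (card F ^ k) (card F ^ (k + 1)) P S"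
proof (induction k)
  case 0
  have fin: "finite F" using Q by (simp add: core_matrix_def)
  have "card (insert None (Some ` F)) = 1 + card F"
    using fin by (simp add: card_image)
  then obtain h where "bij_betw h {..<1 + card F} (insert None (Some ` F))"
    using ex_bij_betw_nat_finite[of "insert None (Some ` F)"] fin
    by (auto simp: atLeast0LessThan)
  from design_pair_reindex[OF this design_pair_bordered[OF Q]] show ?case by auto
next
  case (Suc k)
  then obtain P S where PS:
    "design_pair {..<(1 + card F) * card F ^ k} (card F ^ k) (card F ^ (k + 1)) P S" by blast
  let ?I = "F \<times> {..<(1 + card F) * card F ^ k}"
  have fin: "finite ?I" using Q by (simp add: core_matrix_def)
  have "card ?I = (1 + card F) * card F ^ Suc k" by (simp add: card_cartesian_product algebra_simps)
  then obtain h where h: "bij_betw h {..<(1 + card F) * card F ^ Suc k} ?I"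
    using ex_bij_betw_nat_finite[OF fin] by (auto simp: atLeast0LessThan)
  from design_pair_reindex[OF h design_pair_kron[OF Q PS]] show ?case by auto
qed

section \<open>Parallel classes of lines in the affine plane over Z_p\<close>

text \<open>
  The label of the line through the point \<open>w\<close> in the class \<open>c\<close> of parallel lines;
  \<open>c = p\<close> is the vertical class.
\<close>

definition parallel_class :: "nat \<Rightarrow> nat \<Rightarrow> nat \<times> nat \<Rightarrow> nat" where
  "parallel_class p c w = (if c = p then fst w else (snd w + c * fst w) mod p)"

lemma parallel_class_less:
  "w \<in> {..<p} \<times> {..<p} \<Longrightarrow> parallel_class p c w < p"
  by (auto simp: parallel_class_def)

text \<open>The prime \<open>p\<close> divides (c - d)(a - b) but not c - d, as 0 < |c - d| < p. So
  it divides a - b, and \<open>a\<close>, \<open>b\<close> are reduced residues.\<close>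

lemma mult_cong_imp_eq:
  fixes a b c d p :: nat
  assumes "prime p" "a < p" "b < p" "c < p" "d < p" "c \<noteq> d"
    and "[int c * (int a - int b) = int d * (int a - int b)] (mod int p)"
  shows "a = b"
proof -
  have "int p dvd (int c - int d) * (int a - int b)"
    using assms(7) by (simp add: cong_iff_dvd_diff algebra_simps)
  then have "int p dvd int c - int d \<or> int p dvd int a - int b"
    using assms(1) by (simp add: prime_dvd_mult_iff)
  moreover have "\<not> int p dvd int c - int d"
    using zdvd_not_zless[of "int c - int d" "int p"] zdvd_not_zless[of "int d - int c" "int p"]
      assms by (cases "c < d") (auto simp: dvd_diff_commute)
  moreover have "a = b" if "int p dvd int a - int b"
  proof -
    have "[int a = int b] (mod int p)" using that by (simp add: cong_iff_dvd_diff)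
    then show ?thesis using assms by (simp add: cong_def)
  qed
  ultimately show ?thesis by blast
qed

text \<open>Passing to integers makes the differences available, so that equations for different
  slopes can be compared.\<close>

lemma parallel_class_eq_iff:
  assumes "c < p"
  shows "parallel_class p c (x, y) = parallel_class p c (x', y') \<longleftrightarrow>
         [int y - int y' = int c * (int x' - int x)] (mod int p)"
proof -
  have "parallel_class p c (x, y) = parallel_class p c (x', y') \<longleftrightarrow>
        [int y + int c * int x = int y' + int c * int x'] (mod int p)"
    using assms by (simp add: parallel_class_def cong_def flip: of_nat_mult of_nat_add of_nat_mod)
  then show ?thesis by (simp add: cong_iff_dvd_diff algebra_simps)
qed

text \<open>Lines of different classes share at most one point. As \<open>c < d\<close>, only
  \<open>d\<close> can be the vertical class.\<close>

lemma parallel_class_unique: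
  assumes p: "prime p" and c: "c \<le> p" "d \<le> p" "c < d"
    and u: "u \<in> {..<p} \<times> {..<p}" "v \<in> {..<p} \<times> {..<p}"
    and e: "parallel_class p c u = parallel_class p c v" "parallel_class p d u = parallel_class p d v"
  shows "u = v"
proof -
  obtain x y x' y' where uv: "u = (x, y)" "v = (x', y')" by (metis surj_pair)
  have l: "x < p" "y < p" "x' < p" "y' < p" using u uv by auto
  have cp: "c < p" using c by simp
  have ec: "[int y - int y' = int c * (int x' - int x)] (mod int p)"
    using e(1) parallel_class_eq_iff[OF cp] uv by simp
  \<comment> \<open>The vertical label is the first coordinate itself. For two non-vertical classes
    the same y-difference is obtained with two slopes, which forces the x-difference to
    vanish.\<close>
  have x: "x' = x"
  proof (cases "d = p")
    case True
    then show ?thesis using e(2) uv by (simp add: parallel_class_def)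
  next
    case False
    then have dp: "d < p" using c by simp
    have "[int y - int y' = int d * (int x' - int x)] (mod int p)"
      using e(2) parallel_class_eq_iff[OF dp] uv by simp
    then have "[int c * (int x' - int x) = int d * (int x' - int x)] (mod int p)"
      using ec cong_sym cong_trans by blast
    then show ?thesis
      using mult_cong_imp_eq[OF p l(3,1) cp dp] c by simp
  qed
  then have "[int y = int y'] (mod int p)"
    using ec by (simp add: cong_iff_dvd_diff)
  then show ?thesis using x uv l by (simp add: cong_def)
qed

lemma parallel_class_ex:
  assumes p: "prime p" and u: "u \<in> {..<p} \<times> {..<p}" "v \<in> {..<p} \<times> {..<p}"
  shows "\<exists>c\<le>p. parallel_class p c u = parallel_class p c v"
proof -
  obtain x y x' y' where uv: "u = (x, y)" "v = (x', y')" by (metis surj_pair)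
  have l: "x < p" "y < p" "x' < p" "y' < p" using u uv by auto
  have p0: "p > 0" using p by (simp add: prime_gt_0_nat)
  show ?thesis
  proof (cases "x = x'")
    case True
    then show ?thesis using uv by (auto simp: parallel_class_def intro!: exI[of _ p])
  next
    case False
    \<comment> \<open>A class joining the points has to solve c (x' - x) = y - y' mod p. The map
      \<open>g\<close> is injective on the residues, hence onto, so a solution exists.\<close>
    define g where "g c = nat ((int c * (int x' - int x)) mod int p)" for c
    have gl: "g ` {..<p} \<subseteq> {..<p}" using p0 by (auto simp: g_def nat_less_iff)
    have "inj_on g {..<p}"
    proof (rule inj_onI, rule ccontr)
      fix c d assume cd: "c \<in> {..<p}" "d \<in> {..<p}" "g c = g d" "c \<noteq> d"
      then have "[int c * (int x' - int x) = int d * (int x' - int x)] (mod int p)"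
        using p0 by (simp add: g_def cong_def nat_eq_iff2)
      then show False using mult_cong_imp_eq[OF p l(3,1)] cd False by auto
    qed
    then have "g ` {..<p} = {..<p}" using gl by (simp add: endo_inj_surj)
    moreover have "nat ((int y - int y') mod int p) \<in> {..<p}" using p0 by (simp add: nat_less_iff)
    ultimately obtain c where c: "c < p" "g c = nat ((int y - int y') mod int p)" by (metis imageE lessThan_iff)
    then have "[int y - int y' = int c * (int x' - int x)] (mod int p)"
      using p0 by (simp add: g_def cong_def nat_eq_iff2)
    then show ?thesis using parallel_class_eq_iff[OF c(1)] uv c(1) by (intro exI[of _ c]) simp
  qed
qed

text \<open>Stated as an equivalence so that, for distinct points, a sum over all classes collapses
  to one term.\<close>

lemma parallel_class_ex1:
  assumes p: "prime p" and u: "u \<in> {..<p} \<times> {..<p}" "v \<in> {..<p} \<times> {..<p}" and "u \<noteq> v"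
  shows "\<exists>c\<le>p. \<forall>d\<le>p. parallel_class p d u = parallel_class p d v \<longleftrightarrow> d = c"
proof -
  obtain c where c: "c \<le> p" "parallel_class p c u = parallel_class p c v"
    using parallel_class_ex[OF p u] by blast
  have "d = c" if "d \<le> p" "parallel_class p d u = parallel_class p d v" for d
    using parallel_class_unique[OF p c(1) that(1) _ u c(2) that(2)]
      parallel_class_unique[OF p that(1) c(1) _ u that(2) c(2)] assms(4) by (metis nat_neq_iff)
  then show ?thesis using c by blast
qed

text \<open>Labels in two classes are coordinates: injective by
  \<open>parallel_class_unique\<close>, hence bijective on the finite square.\<close>

lemma parallel_class_bij:
  assumes "prime p" "c \<le> p" "d \<le> p" "c \<noteq> d"
  shows "bij_betw (\<lambda>w. (parallel_class p c w, parallel_class p d w)) ({..<p} \<times> {..<p}) ({..<p} \<times> {..<p})"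
proof -
  have inj: "inj_on (\<lambda>w. (parallel_class p c w, parallel_class p d w)) ({..<p} \<times> {..<p})"
  proof (rule inj_onI)
    fix u v assume "u \<in> {..<p} \<times> {..<p}" "v \<in> {..<p} \<times> {..<p}"
      and "(parallel_class p c u, parallel_class p d u) = (parallel_class p c v, parallel_class p d v)"
    then show "u = v"
      using parallel_class_unique[of p c d u v] parallel_class_unique[of p d c u v] assms
      by (cases "c < d") auto
  qed
  moreover have "(\<lambda>w. (parallel_class p c w, parallel_class p d w)) ` ({..<p} \<times> {..<p}) \<subseteq> {..<p} \<times> {..<p}"
    by (auto simp: parallel_class_less)
  ultimately show ?thesis
    by (simp add: bij_betw_def endo_inj_surj)
qed

text \<open>In the coordinates given by the two labels only the point (s, t) contributes. In matrix
  form this is A_c A_d = J.\<close>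

lemma sum_two_classes:
  assumes "prime p" "c \<le> p" "d \<le> p" "c \<noteq> d" "s < p" "t < p"
  shows "(\<Sum>w\<in>{..<p} \<times> {..<p}. of_bool (s = parallel_class p c w) * of_bool (t = parallel_class p d w)) = (1::complex)"
proof -
  have "(\<Sum>w\<in>{..<p} \<times> {..<p}. of_bool (s = parallel_class p c w) * of_bool (t = parallel_class p d w))
      = (\<Sum>z\<in>{..<p} \<times> {..<p}. of_bool (s = fst z) * of_bool (t = snd z) :: complex)"
    using sum.reindex_bij_betw[OF parallel_class_bij[OF assms(1-4)],
        where g = "\<lambda>z. of_bool (s = fst z) * of_bool (t = snd z) :: complex"] by simp
  also have "\<dots> = (\<Sum>z\<in>{..<p} \<times> {..<p}. if z = (s, t) then 1 else 0)"
    by (intro sum.cong) auto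
  also have "\<dots> = 1" using assms by simp
  finally show ?thesis .
qed

lemma sum_one_class:
  assumes "prime p" "c \<le> p" "s < p"
  shows "(\<Sum>w\<in>{..<p} \<times> {..<p}. of_bool (s = parallel_class p c w)) = (of_nat p :: complex)"
proof -
  \<comment> \<open>Any second class serves: its \<open>p\<close> lines partition the plane, and
    each meets the line \<open>s\<close> in one point.\<close>
  define d where "d = (if c = p then 0 else p)"
  have d: "d \<le> p" "c \<noteq> d" using prime_gt_0_nat[OF assms(1)] assms(2) by (auto simp: d_def)
  have "(\<Sum>w\<in>{..<p} \<times> {..<p}. of_bool (s = parallel_class p c w))
      = (\<Sum>w\<in>{..<p} \<times> {..<p}. \<Sum>t<p. of_bool (s = parallel_class p c w) * of_bool (t = parallel_class p d w) :: complex)"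
  proof (rule sum.cong[OF refl])
    fix w assume "w \<in> {..<p} \<times> {..<p}"
    then have "(\<Sum>t<p. of_bool (t = parallel_class p d w) :: complex) = 1"
      using parallel_class_less[of w p d] by (simp add: of_bool_def)
    then show "of_bool (s = parallel_class p c w) =
        (\<Sum>t<p. of_bool (s = parallel_class p c w) * of_bool (t = parallel_class p d w) :: complex)"
      by (simp flip: sum_distrib_left)
  qed
  also have "\<dots> = (\<Sum>t<p. 1)"
    by (subst sum.swap) (intro sum.cong refl sum_two_classes, use assms d in auto)
  finally show ?thesis by simp
qed

lemma sum_common_classes:
  assumes p: "prime p" and u: "u \<in> {..<p} \<times> {..<p}" "v \<in> {..<p} \<times> {..<p}"
  shows "(\<Sum>c\<le>p. of_bool (parallel_class p c u = parallel_class p c v)) = (1 + of_nat p * delta u v :: complex)"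
proof (cases "u = v")
  case True
  then show ?thesis by (simp add: delta_def)
next
  case False
  obtain c where c: "c \<le> p" "\<And>d. d \<le> p \<Longrightarrow> parallel_class p d u = parallel_class p d v \<longleftrightarrow> d = c"
    using parallel_class_ex1[OF p u False] by blast
  have "(\<Sum>d\<le>p. of_bool (parallel_class p d u = parallel_class p d v))
      = (\<Sum>d\<le>p. if d = c then 1 else 0 :: complex)"
    using c by (intro sum.cong) auto
  then show ?thesis using c False by (simp add: delta_def)
qed

section \<open>The core as an alternating sum over the parallel classes\<close>

definition net_core :: "nat \<Rightarrow> nat \<times> nat \<Rightarrow> nat \<times> nat \<Rightarrow> complex" where
  "net_core p u v = (\<Sum>c\<le>p. (- 1) ^ c * of_bool (parallel_class p c u = parallel_class p c v))"

text \<open>The \<open>p + 1\<close> terms cancel in pairs. This yields the zero diagonal, the zero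
  row sums and the vanishing J part of the Gram sum.\<close>

lemma sum_alternating:
  assumes "odd p"
  shows "(\<Sum>c\<le>p. (- 1) ^ c) = (0 :: complex)"
proof -
  obtain m where "p = 2 * m + 1" using assms by (elim oddE)
  moreover have "(\<Sum>c\<le>2 * m + 1. (- 1) ^ c) = (0 :: complex)" by (induction m) simp_all
  ultimately show ?thesis by simp
qed

lemma cnj_net_core: "cnj (net_core p u v) = net_core p u v"
  by (simp add: net_core_def)

text \<open>In the signed double sum of A_c A_d the J part has coefficient 0, being the square of
  the alternating sum. The terms c = d leave the sum of p A_c - J, which is p (J + p I) - (p + 1) J
  = p^2 I - J.\<close>

lemma net_core_gram:
  assumes p: "prime p" "odd p" and u: "u \<in> {..<p} \<times> {..<p}" "v \<in> {..<p} \<times> {..<p}"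
  shows "gram ({..<p} \<times> {..<p}) (net_core p) (net_core p) u v = of_nat (p * p) * delta u v - 1"
proof -
  let ?b = "\<lambda>c u v. of_bool (parallel_class p c u = parallel_class p c v) :: complex"
  let ?F = "{..<p} \<times> {..<p}"
  have N: "(\<Sum>w\<in>?F. ?b c u w * ?b d v w) = 1 + (if d = c then of_nat p * ?b c u v - 1 else 0)"
    if cd: "c \<le> p" "d \<le> p" for c d
  proof (cases "d = c")
    case True
    \<comment> \<open>A point \<open>w\<close> on the class-\<open>c\<close> lines of both
      \<open>u\<close> and \<open>v\<close> exists only if these lines coincide.\<close>
    have "(\<Sum>w\<in>?F. ?b c u w * ?b c v w) = (\<Sum>w\<in>?F. ?b c u v * ?b c u w)"
      by (intro sum.cong) auto
    also have "\<dots> = ?b c u v * of_nat p"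
      using sum_one_class[OF p(1) cd(1) parallel_class_less[OF u(1)]]
      by (simp only: flip: sum_distrib_left)
    finally show ?thesis using True by simp
  next
    case False
    then show ?thesis
      using sum_two_classes[OF p(1) cd _ parallel_class_less[OF u(1)] parallel_class_less[OF u(2)]] by auto
  qed
  have "gram ?F (net_core p) (net_core p) u v
      = (\<Sum>w\<in>?F. \<Sum>c\<le>p. \<Sum>d\<le>p. (- 1) ^ c * (- 1) ^ d * (?b c u w * ?b d v w))"
    unfolding gram_def cnj_net_core unfolding net_core_def sum_product by (simp add: mult_ac)
  also have "\<dots> = (\<Sum>c\<le>p. \<Sum>w\<in>?F. \<Sum>d\<le>p. (- 1) ^ c * (- 1) ^ d * (?b c u w * ?b d v w))"
    by (rule sum.swap)
  also have "\<dots> = (\<Sum>c\<le>p. \<Sum>d\<le>p. \<Sum>w\<in>?F. (- 1) ^ c * (- 1) ^ d * (?b c u w * ?b d v w))"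
    by (intro sum.cong refl sum.swap)
  also have "\<dots> = (\<Sum>c\<le>p. \<Sum>d\<le>p. (- 1) ^ c * (- 1) ^ d * (1 + (if d = c then of_nat p * ?b c u v - 1 else 0)))"
    using N by (intro sum.cong refl) (simp only: atMost_iff flip: sum_distrib_left)
  \<comment> \<open>The sign disappears from the correction because it is a square when
    \<open>d = c\<close>.\<close>
  also have "\<dots> = (\<Sum>c\<le>p. \<Sum>d\<le>p. (- 1) ^ c * (- 1) ^ d + (if d = c then of_nat p * ?b c u v - 1 else 0))"
    by (intro sum.cong refl) (auto simp: algebra_simps simp flip: power_add mult_2)
  also have "\<dots> = (\<Sum>c\<le>p. (- 1) ^ c) * (\<Sum>d\<le>p. (- 1) ^ d) + (\<Sum>c\<le>p. of_nat p * ?b c u v - 1)"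
    by (simp add: sum.distrib sum_product)
  also have "\<dots> = of_nat p * (\<Sum>c\<le>p. ?b c u v) - of_nat (Suc p)"
    using sum_alternating[OF p(2)] by (simp only: sum_subtractf sum_distrib_left) simp
  finally show ?thesis
    unfolding sum_common_classes[OF p(1) u] by (simp add: algebra_simps)
qed

lemma core_matrix_net_core:
  assumes p: "prime p" "odd p"
  shows "core_matrix ({..<p} \<times> {..<p}) (net_core p)"
  unfolding core_matrix_def
proof (intro conjI ballI impI)
  let ?F = "{..<p} \<times> {..<p}"
  show "finite ?F" by simp
  fix u assume u: "u \<in> ?F"
  show "net_core p u u = 0" using sum_alternating[OF p(2)] by (simp add: net_core_def)
  \<comment> \<open>In each class the line through \<open>u\<close> has \<open>p\<close> points, so
    the row sum is \<open>p\<close> times the alternating sum.\<close>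
  have "(\<Sum>w\<in>?F. net_core p u w) = (\<Sum>c\<le>p. (- 1) ^ c * (\<Sum>w\<in>?F. of_bool (parallel_class p c u = parallel_class p c w)))"
    unfolding net_core_def by (subst sum.swap) (simp only: sum_distrib_left)
  also have "\<dots> = (\<Sum>c\<le>p. (- 1) ^ c * of_nat p)"
    by (intro sum.cong refl arg_cong2[where f = "(*)"] sum_one_class[OF p(1) _ parallel_class_less[OF u]]) simp
  also have "\<dots> = 0" using sum_alternating[OF p(2)] by (simp flip: sum_distrib_right)
  finally show "(\<Sum>w\<in>?F. net_core p u w) = 0" .
  fix v assume v: "v \<in> ?F"
  show "net_core p u v = net_core p v u" by (simp add: net_core_def eq_commute)
  show "gram ?F (net_core p) (net_core p) u v = of_nat (card ?F) * delta u v - 1"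
    using net_core_gram[OF p u v] by (simp add: card_cartesian_product)
  assume ne: "u \<noteq> v"
  obtain c where c: "c \<le> p" "\<And>d. d \<le> p \<Longrightarrow> parallel_class p d u = parallel_class p d v \<longleftrightarrow> d = c"
    using parallel_class_ex1[OF p(1) u v ne] by blast
  have "net_core p u v = (\<Sum>d\<le>p. if d = c then (- 1) ^ c else 0)"
    unfolding net_core_def using c by (intro sum.cong) auto
  then show "net_core p u v \<in> {1, - 1}" using c by (cases "even c") simp_all
qed

section \<open>From coefficient matrices to matrices of polynomials\<close>

lemma cpoly_const_0: "cpoly_const 0 = 0"
  by (simp add: cpoly_const_def)

lemma cpoly_const_add: "cpoly_const (a + b) = cpoly_const a + cpoly_const b"
  by (simp add: cpoly_const_def single_add)

lemma cpoly_const_mult: "cpoly_const (a * b) = cpoly_const a * cpoly_const b"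
  by (simp add: cpoly_const_def mult_single)

lemma cpoly_const_sum: "cpoly_const (\<Sum>x\<in>A. f x) = (\<Sum>x\<in>A. cpoly_const (f x))"
  by (induction A rule: infinite_finite_induct) (simp_all add: cpoly_const_0 cpoly_const_add)

lemma cpoly_const_of_nat: "cpoly_const (of_nat n) = of_nat n"
  by (simp add: cpoly_const_def single_of_nat)

lemma cpoly_cnj_const_indet: "cpoly_cnj (cpoly_const u * indet l) = cpoly_const (cnj u) * indet l"
  unfolding cpoly_cnj_def cpoly_const_def indet_def mult_single
  by (simp add: poly_mapping_eq_iff fun_eq_iff map.rep_eq lookup_single when_def)

lemma cpoly_cnj_0: "cpoly_cnj 0 = 0"
  using cpoly_cnj_const_indet[of 0 0] by (simp add: cpoly_const_0)

text \<open>The indeterminates commute, so D D* has coefficient P P* at x_0^2, S S* at x_1^2, and P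
  S* + S P* at x_0 x_1. These are the three Gram conditions of \<open>design_pair\<close>.\<close>

lemma is_COD_of_design_pair:
  assumes d: "design_pair {..<n} a b P S"
  shows "is_COD n [a, b] (mat n n (\<lambda>(i, j). cpoly_const (P i j) * indet 0 + cpoly_const (S i j) * indet 1))"
    (is "is_COD n _ ?D")
proof -
  have ent: "P i j = 0 \<and> S i j \<in> insert 0 quaternary_units \<or>
             S i j = 0 \<and> P i j \<in> insert 0 quaternary_units" if "i < n" "j < n" for i j
    using d that by (simp add: design_pair_def)
  \<comment> \<open>At most one of the two terms is nonzero, so conjugation reduces to the case of a
    single term.\<close>
  have cj: "cpoly_cnj (cpoly_const (P i j) * indet 0 + cpoly_const (S i j) * indet 1)
      = cpoly_const (cnj (P i j)) * indet 0 + cpoly_const (cnj (S i j)) * indet 1"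
    if "i < n" "j < n" for i j
    using ent[OF that] by (auto simp: cpoly_const_0 cpoly_cnj_0 cpoly_cnj_const_indet)
  have el: "elements_mat ?D \<subseteq>
      {0} \<union> {cpoly_const u * indet l | u l. u \<in> {1, - 1, \<i>, - \<i>} \<and> l < length [a, b]}"
  proof
    fix z assume "z \<in> elements_mat ?D"
    then obtain i j where ij: "i < n" "j < n"
      and z: "z = cpoly_const (P i j) * indet 0 + cpoly_const (S i j) * indet 1"
      by (auto simp: elements_mat_def)
    have "z = 0 \<or> (\<exists>u\<in>quaternary_units. z = cpoly_const u * indet 0 \<or> z = cpoly_const u * indet 1)"
      using ent[OF ij] unfolding z by (auto simp: cpoly_const_0)
    then show "z \<in> {0} \<union> {cpoly_const u * indet l | u l. u \<in> {1, - 1, \<i>, - \<i>} \<and> l < length [a, b]}"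
      unfolding quaternary_units_def[symmetric] by fastforce
  qed
  have "?D * conj_transpose ?D = (\<Sum>l<length [a, b]. of_nat ([a, b] ! l) * indet l ^ 2) \<cdot>\<^sub>m 1\<^sub>m n"
  proof (rule eq_matI)
    fix i j
    assume "i < dim_row ((\<Sum>l<length [a, b]. of_nat ([a, b] ! l) * indet l ^ 2) \<cdot>\<^sub>m 1\<^sub>m n)"
      and "j < dim_col ((\<Sum>l<length [a, b]. of_nat ([a, b] ! l) * indet l ^ 2) \<cdot>\<^sub>m 1\<^sub>m n)"
    then have ij: "i < n" "j < n" by auto
    have "(?D * conj_transpose ?D) $$ (i, j) =
        (\<Sum>k<n. (cpoly_const (P i k) * indet 0 + cpoly_const (S i k) * indet 1) *
                (cpoly_const (cnj (P j k)) * indet 0 + cpoly_const (cnj (S j k)) * indet 1))"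
      using ij cj by (simp add: conj_transpose_def scalar_prod_def atLeast0LessThan)
    also have "\<dots> = cpoly_const (gram {..<n} P P i j) * indet 0 ^ 2 +
        cpoly_const (gram {..<n} S S i j) * indet 1 ^ 2 +
        cpoly_const (gram {..<n} P S i j + gram {..<n} S P i j) * (indet 0 * indet 1)"
      unfolding gram_def
      by (simp add: cpoly_const_sum cpoly_const_add cpoly_const_mult sum.distrib sum_distrib_left sum_distrib_right
          algebra_simps power2_eq_square)
    also have "\<dots> = cpoly_const (of_nat a * delta i j) * indet 0 ^ 2 +
        cpoly_const (of_nat b * delta i j) * indet 1 ^ 2"
      using d ij by (simp add: design_pair_def cpoly_const_0)
    also have "\<dots> = ((\<Sum>l<length [a, b]. of_nat ([a, b] ! l) * indet l ^ 2) \<cdot>\<^sub>m 1\<^sub>m n) $$ (i, j)"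
      using ij by (simp add: delta_def cpoly_const_0 cpoly_const_of_nat)
    finally show "(?D * conj_transpose ?D) $$ (i, j) =
        ((\<Sum>l<length [a, b]. of_nat ([a, b] ! l) * indet l ^ 2) \<cdot>\<^sub>m 1\<^sub>m n) $$ (i, j)" .
  qed (simp_all add: conj_transpose_def)
  then show ?thesis using el by (simp add: is_COD_def)
qed

theorem theorem4p4:
  fixes p k :: nat
  assumes "prime p" and "odd p"
  shows "\<exists>D. is_COD ((1 + p ^ 2) * p ^ (2 * k)) [p ^ (2 * k), p ^ (2 * k + 2)] D"
proof -
  have q: "card ({..<p} \<times> {..<p}) = p ^ 2"
    by (simp add: card_cartesian_product power2_eq_square)
  have e: "(p ^ 2) ^ k = p ^ (2 * k)" "(p ^ 2) ^ (k + 1) = p ^ (2 * k + 2)"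
    by (simp_all add: power_add power_mult power2_eq_square)
  from design_pair_exists[OF core_matrix_net_core[OF assms], of k]
  obtain P S where "design_pair {..<(1 + p ^ 2) * p ^ (2 * k)} (p ^ (2 * k)) (p ^ (2 * k + 2)) P S"
    unfolding q e by blast
  from is_COD_of_design_pair[OF this] show ?thesis by blast
qed

end
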